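(* For a finite twin-free poset $P$, the following are equivalent: (1) $P$ is a unit OC interval order; (2) $P$ is an $\{A,B\}$-order; (3) $P$ is an interval order that contains no induced subposet isomorphic to any member of the family $\mathcal F=\{\mathbf{4}+\mathbf{1},\ \mathbf{3}+\mathbf{1}+\mathbf{1},\ Z,\ D,\ Y,\ Y^{d}\}$.
   Context: Interval types: every interval $I_v$ has left endpoint $L(v)$, right endpoint $R(v)$, center $c(v)=(L(v)+R(v))/2$, and one of four types: $A$ (endpoints closed, center closed), $B$ (endpoints open, center open), $C$ (endpoints closed, center open), $D$ (endpoints open, center closed); the center always belongs to the interval. For nonempty $S\subseteq\{A,B,C,D\}$, an $S$-representation of a poset $(X,\prec)$ assigns to each $x\in X$ an interval $I_x$, all of the same positive length, each of type in $S$, such that $x\prec y$ iff (i) $R(x)<c(y)$, or (ii) $R(x)=c(y)$, at least one of $R(x),c(y)$ is open, and at least one of $L(y),c(x)$ is open. An $S$-order is a poset with an $S$-representation. An interval order is a poset in which each $x$ can be assigned a real interval $I_x$ with $x\prec y$ iff every point of $I_x$ is less than every point of $I_y$. A unit OC interval order is a poset in which each $x$ can be assigned a real interval $I_x$, all of the same positive length, each either open or closed, with $x\prec y$ iff every point of $I_x$ is less than every point of $I_y$. Two elements are twins if they have the same comparabilities (the same sets of elements above and below them); a poset is twin-free if it has no twins. The forbidden posets: $\mathbf{4}+\mathbf{1}$ is a 4-element chain plus an element incomparable to all; $\mathbf{3}+\mathbf{1}+\mathbf{1}$ is a 3-element chain plus two elements incomparable to each other and to the chain; $Z$ has elements $a\prec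 b\prec c\prec d$, $e$, $f$ with the only further relations $e\prec d$ and $a\prec f$; $D$ has elements $p,q,r,t,s$ with $p\prec q\prec t$, $p\prec r\prec t$, $q\parallel r$, and $s$ incomparable to all others; $Y$ has elements $a,b,c,d,e$ with $a\prec b\prec c$, $b\prec d$ (hence $a\prec d$), $c\parallel d$, and $e$ incomparable to all others; $Y^d$ is the dual of $Y$ (reverse all relations). *)

theory Defs
  imports "HOL-Analysis.Analysis"
begin

text \<open>A poset is a ground set together with its strict order, given as a set of pairs.\<close>

type_synonym 'a poset = "'a set \<times> 'a rel"

definition is_poset :: "'a poset \<Rightarrow> bool" where
  "is_poset P \<longleftrightarrow> (case P of (X, r) \<Rightarrow> r \<subseteq> X \<times> X \<and> irrefl r \<and> trans r)"

definition twins :: "'a poset \<Rightarrow> 'a \<Rightarrow> 'a \<Rightarrow> bool" where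
  "twins P x y \<longleftrightarrow> (case P of (X, r) \<Rightarrow>
     x \<in> X \<and> y \<in> X \<and> x \<noteq> y \<and>
     {z \<in> X. (z, x) \<in> r} = {z \<in> X. (z, y) \<in> r} \<and>
     {z \<in> X. (x, z) \<in> r} = {z \<in> X. (y, z) \<in> r})"

definition twin_free :: "'a poset \<Rightarrow> bool" where
  "twin_free P \<longleftrightarrow> (\<forall>x y. \<not> twins P x y)"

definition induced_subposet :: "'a poset \<Rightarrow> 'a set \<Rightarrow> 'a poset" where
  "induced_subposet P Y = (Y, snd P \<inter> Y \<times> Y)"

definition poset_iso :: "'a poset \<Rightarrow> 'b poset \<Rightarrow> bool" where
  "poset_iso P Q \<longleftrightarrow> (\<exists>f. bij_betw f (fst P) (fst Q) \<and>
     (\<forall>x \<in> fst P. \<forall>y \<in> fst P. (x, y) \<in> snd P \<longleftrightarrow> (f x, f y) \<in> snd Q))"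

definition contains_induced :: "'a poset \<Rightarrow> 'b poset \<Rightarrow> bool" where
  "contains_induced P Q \<longleftrightarrow> (\<exists>Y \<subseteq> fst P. poset_iso (induced_subposet P Y) Q)"

definition dual_poset :: "'a poset \<Rightarrow> 'a poset" where
  "dual_poset P = (fst P, (snd P)\<inverse>)"

definition set_precedes :: "real set \<Rightarrow> real set \<Rightarrow> bool" where
  "set_precedes I J \<longleftrightarrow> (\<forall>s \<in> I. \<forall>t \<in> J. s < t)"

definition interval_order :: "'a poset \<Rightarrow> bool" where
  "interval_order P \<longleftrightarrow> is_poset P \<and>
     (\<exists>I :: 'a \<Rightarrow> real set.
        (\<forall>x \<in> fst P. is_interval (I x) \<and> I x \<noteq> {}) \<and>
        (\<forall>x \<in> fst P. \<forall>y \<in> fst P. (x, y) \<in> snd P \<longleftrightarrow> set_precedes (I x) (I y)))"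

definition unit_OC_interval_order :: "'a poset \<Rightarrow> bool" where
  "unit_OC_interval_order P \<longleftrightarrow> is_poset P \<and>
     (\<exists>(I :: 'a \<Rightarrow> real set) len. len > 0 \<and>
        (\<forall>x \<in> fst P. \<exists>l. I x = {l<..<l + len} \<or> I x = {l..l + len}) \<and>
        (\<forall>x \<in> fst P. \<forall>y \<in> fst P. (x, y) \<in> snd P \<longleftrightarrow> set_precedes (I x) (I y)))"

datatype itype = Type_A | Type_B | Type_C | Type_D

fun endpoints_open :: "itype \<Rightarrow> bool" where
  "endpoints_open Type_A = False"
| "endpoints_open Type_B = True"
| "endpoints_open Type_C = False"
| "endpoints_open Type_D = True"

fun center_open :: "itype \<Rightarrow> bool" where
  "center_open Type_A = False"
| "center_open Type_B = True"
| "center_open Type_C = True"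
| "center_open Type_D = False"

text \<open>The center belongs to the interval whatever its type; open and closed centers differ
  only through the comparison rule in \<open>typed_precedes\<close>.\<close>

datatype typed_interval = Typed_Interval (left: real) (right: real) (type_of: itype)

definition center :: "typed_interval \<Rightarrow> real" where
  "center I = (left I + right I) / 2"

definition typed_precedes :: "typed_interval \<Rightarrow> typed_interval \<Rightarrow> bool" where
  "typed_precedes I J \<longleftrightarrow>
     right I < center J \<or>
     (right I = center J \<and>
      (endpoints_open (type_of I) \<or> center_open (type_of J)) \<and>
      (endpoints_open (type_of J) \<or> center_open (type_of I)))"

definition S_representation :: "itype set \<Rightarrow> 'a poset \<Rightarrow> ('a \<Rightarrow> typed_interval) \<Rightarrow> bool" where
  "S_representation S P I \<longleftrightarrow>
     (\<exists>len > 0. \<forall>x \<in> fst P. right (I x) - left (I x) = len) \<and>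
     (\<forall>x \<in> fst P. type_of (I x) \<in> S) \<and>
     (\<forall>x \<in> fst P. \<forall>y \<in> fst P. (x, y) \<in> snd P \<longleftrightarrow> typed_precedes (I x) (I y))"

definition S_order :: "itype set \<Rightarrow> 'a poset \<Rightarrow> bool" where
  "S_order S P \<longleftrightarrow> is_poset P \<and> (\<exists>I. S_representation S P I)"

definition four_plus_one :: "nat poset" where
  "four_plus_one = ({0, 1, 2, 3, 4}, {(0,1), (0,2), (0,3), (1,2), (1,3), (2,3)})"

definition three_plus_one_plus_one :: "nat poset" where
  "three_plus_one_plus_one = ({0, 1, 2, 3, 4}, {(0,1), (0,2), (1,2)})"

text \<open>Vertices \<open>a, b, c, d, e, f\<close> are \<open>0, 1, 2, 3, 4, 5\<close>: the chain
  \<open>a \<prec> b \<prec> c \<prec> d\<close> together with \<open>e \<prec> d\<close> and \<open>a \<prec> f\<close>.\<close>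

definition Z_poset :: "nat poset" where
  "Z_poset = ({0, 1, 2, 3, 4, 5},
     {(0,1), (0,2), (0,3), (1,2), (1,3), (2,3), (4,3), (0,5)})"

text \<open>Vertices \<open>p, q, r, t, s\<close> are \<open>0, 1, 2, 3, 4\<close>: \<open>p \<prec> q \<prec> t\<close> and
  \<open>p \<prec> r \<prec> t\<close>, with \<open>s\<close> isolated.\<close>

definition D_poset :: "nat poset" where
  "D_poset = ({0, 1, 2, 3, 4}, {(0,1), (0,2), (0,3), (1,3), (2,3)})"

text \<open>Vertices \<open>a, b, c, d, e\<close> are \<open>0, 1, 2, 3, 4\<close>: \<open>a \<prec> b \<prec> c\<close> and
  \<open>b \<prec> d\<close>, with \<open>e\<close> isolated.\<close>

definition Y_poset :: "nat poset" where
  "Y_poset = ({0, 1, 2, 3, 4}, {(0,1), (0,2), (0,3), (1,2), (1,3)})"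

definition forbidden_family :: "nat poset set" where
  "forbidden_family = {four_plus_one, three_plus_one_plus_one, Z_poset, D_poset, Y_poset,
     dual_poset Y_poset}"

end

theory Submission
  imports Defs
begin

text \<open>
  Both kinds of representation amount to left endpoints \<open>l\<close> and a set of open elements such that
  \<open>x \<prec> y\<close> iff \<open>l x + len < l y\<close>, or \<open>l x + len = l y\<close> and \<open>x\<close> or \<open>y\<close> is open.  In such a model a
  \<open>\<^bold>3 + \<^bold>1\<close>, that is \<open>a \<prec> b \<prec> c\<close> with \<open>e\<close> incomparable to all three, is rigid: \<open>b\<close> is the
  interior of the closed interval \<open>e\<close>, and \<open>a\<close> and \<open>c\<close> are closed and touch \<open>e\<close>.  Together with
  twin-freeness this excludes the forbidden posets.

  Conversely, the forbidden posets and twin-freeness make \<open>a\<close>, \<open>c\<close> and \<open>e\<close> functions of the middle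
  element \<open>b\<close>, none of them being a middle element itself.  The non-middle elements form a
  semiorder, linearly ordered by inclusion of the sets of predecessors and successors in the whole
  poset.  Adding them in this order, one places closed unit intervals so that moreover \<open>a\<close> touches
  \<open>e\<close> and \<open>e\<close> touches \<open>c\<close> for every such configuration; each middle element then becomes the
  interior of its \<open>e\<close>.
\<close>

section \<open>Left endpoint models\<close>

definition endpoint_model :: "'a poset \<Rightarrow> ('a \<Rightarrow> real) \<Rightarrow> ('a \<Rightarrow> bool) \<Rightarrow> real \<Rightarrow> bool" where
  "endpoint_model P l opn len \<longleftrightarrow> len > 0 \<and>
     (\<forall>x \<in> fst P. \<forall>y \<in> fst P. (x, y) \<in> snd P \<longleftrightarrow>
        l x + len < l y \<or> (l x + len = l y \<and> (opn x \<or> opn y)))"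

definition oc_interval :: "real \<Rightarrow> real \<Rightarrow> bool \<Rightarrow> real set" where
  "oc_interval len l opn = (if opn then {l<..<l + len} else {l..l + len})"

lemma oc_interval_precedes_iff:
  assumes "len > 0"
  shows "set_precedes (oc_interval len l p) (oc_interval len m q) \<longleftrightarrow>
    l + len < m \<or> (l + len = m \<and> (p \<or> q))"
proof
  assume R: "l + len < m \<or> (l + len = m \<and> (p \<or> q))"
  show "set_precedes (oc_interval len l p) (oc_interval len m q)"
    unfolding set_precedes_def oc_interval_def using R by (auto split: if_splits)
next
  assume *: "set_precedes (oc_interval len l p) (oc_interval len m q)"
  show "l + len < m \<or> (l + len = m \<and> (p \<or> q))"
  proof (rule ccontr)
    assume neg: "\<not> ?thesis"
    show False
    proof (cases "l + len = m")
      case True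
      then have "l + len \<in> oc_interval len l p" "l + len \<in> oc_interval len m q"
        using neg assms by (auto simp: oc_interval_def)
      then show False
        using * by (auto simp: set_precedes_def)
    next
      case False
      then have lt: "m < l + len"
        using neg by auto
      \<comment> \<open>Interior points \<open>t < s\<close> refute precedence whatever the types
        are: \<open>s\<close> is taken in the first interval to the right of \<open>m\<close>, and
        \<open>t\<close> in the second between \<open>m\<close> and \<open>s\<close>.\<close>
      obtain s where s: "max l m < s" "s < l + len"
        using dense[of "max l m" "l + len"] lt assms by auto
      obtain t where t: "m < t" "t < min s (m + len)"
        using dense[of m "min s (m + len)"] s assms by auto
      have "s \<in> oc_interval len l p" "t \<in> oc_interval len m q"
        using s t by (auto simp: oc_interval_def)
      then show False
        using * t by (force simp: set_precedes_def)
    qed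
  qed
qed

lemma unit_OC_iff_endpoint_model:
  "unit_OC_interval_order P \<longleftrightarrow> is_poset P \<and> (\<exists>l opn len. endpoint_model P l opn len)"
proof
  assume "unit_OC_interval_order P"
  then obtain I len where P: "is_poset P" and len: "len > 0"
    and I: "\<forall>x \<in> fst P. \<exists>l. I x = {l<..<l + len} \<or> I x = {l..l + len}"
    and rel: "\<forall>x \<in> fst P. \<forall>y \<in> fst P. (x, y) \<in> snd P \<longleftrightarrow> set_precedes (I x) (I y)"
    unfolding unit_OC_interval_order_def by blast
  have "\<forall>x \<in> fst P. \<exists>l p. I x = oc_interval len l p"
  proof
    fix x assume "x \<in> fst P"
    with I obtain l where "I x = {l<..<l + len} \<or> I x = {l..l + len}"
      by blast
    then have "I x = oc_interval len l True \<or> I x = oc_interval len l False"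
      by (simp add: oc_interval_def)
    then show "\<exists>l p. I x = oc_interval len l p"
      by blast
  qed
  then obtain l opn where "\<forall>x \<in> fst P. I x = oc_interval len (l x) (opn x)"
    by metis
  then have "endpoint_model P l opn len"
    using rel len by (simp add: endpoint_model_def oc_interval_precedes_iff)
  with P show "is_poset P \<and> (\<exists>l opn len. endpoint_model P l opn len)"
    by blast
next
  assume "is_poset P \<and> (\<exists>l opn len. endpoint_model P l opn len)"
  then obtain l opn len where P: "is_poset P" and m: "endpoint_model P l opn len"
    by blast
  let ?I = "\<lambda>x. oc_interval len (l x) (opn x)"
  have "len > 0" "\<forall>x \<in> fst P. \<forall>y \<in> fst P. (x, y) \<in> snd P \<longleftrightarrow> set_precedes (?I x) (?I y)"
    using m by (simp_all add: endpoint_model_def oc_interval_precedes_iff)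
  moreover have "\<forall>x \<in> fst P. \<exists>l. ?I x = {l<..<l + len} \<or> ?I x = {l..l + len}"
    by (auto simp: oc_interval_def)
  ultimately show "unit_OC_interval_order P"
    unfolding unit_OC_interval_order_def using P
    by (intro conjI exI[of _ ?I] exI[of _ len])
qed

text \<open>Only the right half \<open>[c(x), R(x)]\<close> of a typed interval matters, so the length is halved.\<close>

lemma AB_order_iff_endpoint_model:
  "S_order {Type_A, Type_B} P \<longleftrightarrow> is_poset P \<and> (\<exists>l opn len. endpoint_model P l opn len)"
proof
  assume "S_order {Type_A, Type_B} P"
  then obtain I len where P: "is_poset P" and len: "len > 0"
    and wd: "\<forall>x \<in> fst P. right (I x) - left (I x) = len"
    and ty: "\<forall>x \<in> fst P. type_of (I x) \<in> {Type_A, Type_B}"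
    and rel: "\<forall>x \<in> fst P. \<forall>y \<in> fst P. (x, y) \<in> snd P \<longleftrightarrow> typed_precedes (I x) (I y)"
    unfolding S_order_def S_representation_def by blast
  have rt: "right (I x) = center (I x) + len / 2" if "x \<in> fst P" for x
  proof -
    have "right (I x) - left (I x) = len"
      using wd that by blast
    then show ?thesis
      by (simp add: center_def field_simps)
  qed
  have op: "endpoints_open (type_of (I x)) = (type_of (I x) = Type_B)"
    "center_open (type_of (I x)) = (type_of (I x) = Type_B)" if "x \<in> fst P" for x
    using ty that by auto
  have "endpoint_model P (\<lambda>x. center (I x)) (\<lambda>x. type_of (I x) = Type_B) (len / 2)"
    unfolding endpoint_model_def using len rel by (auto simp: typed_precedes_def rt op)
  with P show "is_poset P \<and> (\<exists>l opn len. endpoint_model P l opn len)"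
    by blast
next
  assume "is_poset P \<and> (\<exists>l opn len. endpoint_model P l opn len)"
  then obtain l opn len where P: "is_poset P" and m: "endpoint_model P l opn len"
    by blast
  \<comment> \<open>Radius \<open>len\<close> around the center \<open>l x\<close> makes the right
    half of \<open>I x\<close> the interval of the model.\<close>
  define I where
    "I x = Typed_Interval (l x - len) (l x + len) (if opn x then Type_B else Type_A)" for x
  have "typed_precedes (I x) (I y) \<longleftrightarrow> l x + len < l y \<or> (l x + len = l y \<and> (opn x \<or> opn y))"
    for x y
    by (auto simp: typed_precedes_def I_def center_def)
  then have "S_representation {Type_A, Type_B} P I"
    using m unfolding S_representation_def endpoint_model_def
    by (auto simp: I_def intro!: exI[of _ "2 * len"])
  with P show "S_order {Type_A, Type_B} P"
    unfolding S_order_def by blast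
qed

lemma endpoint_model_interval_order:
  assumes "is_poset P" "endpoint_model P l opn len"
  shows "interval_order P"
proof -
  let ?I = "\<lambda>x. oc_interval len (l x) (opn x)"
  have len: "len > 0"
    using assms by (simp add: endpoint_model_def)
  have "\<forall>x \<in> fst P. is_interval (?I x) \<and> ?I x \<noteq> {}"
    using len by (auto simp: oc_interval_def is_interval_oo is_interval_cc)
  moreover have "\<forall>x \<in> fst P. \<forall>y \<in> fst P. (x, y) \<in> snd P \<longleftrightarrow> set_precedes (?I x) (?I y)"
    using assms len by (simp add: endpoint_model_def oc_interval_precedes_iff)
  ultimately show ?thesis
    unfolding interval_order_def using assms(1) by (intro conjI exI[of _ ?I])
qed

section \<open>Induced copies of the forbidden posets\<close>

text \<open>Replaces a subset with an isomorphism onto \<open>Q\<close> by the inverse map, an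
  embedding \<open>g\<close> of \<open>Q\<close> that can be evaluated at concrete vertices.\<close>

lemma contains_induced_iff:
  "contains_induced P Q \<longleftrightarrow> (\<exists>g. inj_on g (fst Q) \<and> g ` fst Q \<subseteq> fst P \<and>
     (\<forall>i \<in> fst Q. \<forall>j \<in> fst Q. (i, j) \<in> snd Q \<longleftrightarrow> (g i, g j) \<in> snd P))"
proof
  assume "contains_induced P Q"
  then obtain Y f where Y: "Y \<subseteq> fst P" and f: "bij_betw f Y (fst Q)"
    and rel: "\<forall>x \<in> Y. \<forall>y \<in> Y. (x, y) \<in> snd P \<longleftrightarrow> (f x, f y) \<in> snd Q"
    unfolding contains_induced_def poset_iso_def induced_subposet_def by auto
  let ?g = "inv_into Y f"
  have g: "bij_betw ?g (fst Q) Y"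
    using f by (rule bij_betw_inv_into)
  have "f (?g i) = i" "?g i \<in> Y" if "i \<in> fst Q" for i
    using that f g by (auto simp: bij_betw_inv_into_right bij_betwE)
  then have "\<forall>i \<in> fst Q. \<forall>j \<in> fst Q. (i, j) \<in> snd Q \<longleftrightarrow> (?g i, ?g j) \<in> snd P"
    using rel by simp
  then show "\<exists>g. inj_on g (fst Q) \<and> g ` fst Q \<subseteq> fst P \<and>
     (\<forall>i \<in> fst Q. \<forall>j \<in> fst Q. (i, j) \<in> snd Q \<longleftrightarrow> (g i, g j) \<in> snd P)"
    using g Y unfolding bij_betw_def by blast
next
  assume "\<exists>g. inj_on g (fst Q) \<and> g ` fst Q \<subseteq> fst P \<and>
     (\<forall>i \<in> fst Q. \<forall>j \<in> fst Q. (i, j) \<in> snd Q \<longleftrightarrow> (g i, g j) \<in> snd P)"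
  then obtain g where inj: "inj_on g (fst Q)" and sub: "g ` fst Q \<subseteq> fst P"
    and rel: "\<forall>i \<in> fst Q. \<forall>j \<in> fst Q. (i, j) \<in> snd Q \<longleftrightarrow> (g i, g j) \<in> snd P"
    by blast
  let ?f = "inv_into (fst Q) g"
  have "bij_betw ?f (g ` fst Q) (fst Q)"
    using inj by (simp add: bij_betw_inv_into inj_on_imp_bij_betw)
  moreover have "?f (g i) = i" if "i \<in> fst Q" for i
    using that inj by simp
  ultimately have "poset_iso (induced_subposet P (g ` fst Q)) Q"
    unfolding poset_iso_def induced_subposet_def using rel
    by (intro exI[of _ ?f]) auto
  with sub show "contains_induced P Q"
    unfolding contains_induced_def by blast
qed

text \<open>The form in which exclusions are applied: \<open>xs\<close> names the images of the
  vertices 0, 1, ... in order, so the embedding is list indexing.\<close>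

lemma not_contains_induced_list:
  assumes "\<not> contains_induced (X, r) (Y, s)" "distinct xs" "set xs \<subseteq> X"
    "Y = {..<length xs}"
    "\<And>i j. i < length xs \<Longrightarrow> j < length xs \<Longrightarrow> (i, j) \<in> s \<longleftrightarrow> (xs ! i, xs ! j) \<in> r"
  shows False
proof -
  have "inj_on ((!) xs) Y"
    using assms by (auto simp: inj_on_def nth_eq_iff_index_eq)
  moreover have "(!) xs ` Y \<subseteq> X"
    using assms by (auto simp: subset_iff)
  ultimately have "contains_induced (X, r) (Y, s)"
    unfolding contains_induced_iff using assms(4,5) by (intro exI[of _ "(!) xs"]) auto
  with assms(1) show False ..
qed

section \<open>Posets whose order is a Ferrers relation, that is, without an induced 2 + 2\<close>

locale ferrers_poset =
  fixes X :: "'a set" and r :: "'a rel"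
  assumes rel_sub: "r \<subseteq> X \<times> X"
    and irr: "(x, x) \<notin> r"
    and tr: "(x, y) \<in> r \<Longrightarrow> (y, z) \<in> r \<Longrightarrow> (x, z) \<in> r"
    and ferrers: "(x, y) \<in> r \<Longrightarrow> (z, w) \<in> r \<Longrightarrow> z \<in> X \<Longrightarrow> y \<in> X \<Longrightarrow> (z, y) \<notin> r \<Longrightarrow> (x, w) \<in> r"
begin

abbreviation prec (infix "\<lhd>" 50) where "x \<lhd> y \<equiv> (x, y) \<in> r"

lemma precD: "x \<lhd> y \<Longrightarrow> x \<in> X \<and> y \<in> X"
  using rel_sub by auto

text \<open>A 3 + 1 with chain \<open>a\<close>, \<open>b\<close>, \<open>c\<close> and isolated
  element \<open>e\<close>. By transitivity the two negations make \<open>e\<close> incomparable to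
  the whole chain.\<close>

definition three_one :: "'a \<Rightarrow> 'a \<Rightarrow> 'a \<Rightarrow> 'a \<Rightarrow> bool" where
  "three_one a b c e \<longleftrightarrow> a \<lhd> b \<and> b \<lhd> c \<and> e \<in> X \<and> \<not> a \<lhd> e \<and> \<not> e \<lhd> c"

lemma three_oneD:
  assumes "three_one a b c e"
  shows "a \<lhd> b" "b \<lhd> c" "a \<lhd> c" "\<not> a \<lhd> e" "\<not> e \<lhd> c" "\<not> e \<lhd> a" "\<not> e \<lhd> b" "\<not> b \<lhd> e" "\<not> c \<lhd> e"
    "a \<in> X" "b \<in> X" "c \<in> X" "e \<in> X"
  using assms precD[of a b] precD[of b c] tr[of a b c] tr[of a b e] tr[of e a c] tr[of e b c]
    tr[of e a b] tr[of b c e] tr[of a c e] unfolding three_one_def by blast+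

end

lemma ferrers_poset_dual:
  assumes "ferrers_poset X r"
  shows "ferrers_poset X (r\<inverse>)"
proof -
  interpret ferrers_poset X r by fact
  show ?thesis
  proof
    show "r\<inverse> \<subseteq> X \<times> X"
      using rel_sub by blast
    show "(x, x) \<notin> r\<inverse>" for x
      using irr by simp
    show "(x, z) \<in> r\<inverse>" if "(x, y) \<in> r\<inverse>" "(y, z) \<in> r\<inverse>" for x y z
      using that tr[of z y x] by simp
    show "(x, w) \<in> r\<inverse>" if "(x, y) \<in> r\<inverse>" "(z, w) \<in> r\<inverse>" "z \<in> X" "y \<in> X" "(z, y) \<notin> r\<inverse>"
      for x y z w
      using that ferrers[of w z y x] by simp
  qed
qed

text \<open>The exclusions in directly usable form: \<open>no_four_one\<close> stands for 4 + 1,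
  \<open>three_one_isolated\<close> for 3 + 1 + 1, \<open>three_one_top\<close> for Y,
  \<open>three_one_bot\<close> for the dual of Y, and \<open>no_Z\<close> for Z.\<close>

locale rigid_poset = ferrers_poset +
  assumes twin: "x \<in> X \<Longrightarrow> y \<in> X \<Longrightarrow> (\<And>z. (z, x) \<in> r \<longleftrightarrow> (z, y) \<in> r) \<Longrightarrow>
      (\<And>z. (x, z) \<in> r \<longleftrightarrow> (y, z) \<in> r) \<Longrightarrow> x = y"
    and no_four_one: "a \<lhd> b \<Longrightarrow> b \<lhd> c \<Longrightarrow> c \<lhd> d \<Longrightarrow> e \<in> X \<Longrightarrow> \<not> a \<lhd> e \<Longrightarrow> \<not> e \<lhd> d \<Longrightarrow> False"
    and three_one_isolated: "three_one a b c e \<Longrightarrow> three_one a b c f \<Longrightarrow> e = f"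
    and three_one_top: "three_one a b c e \<Longrightarrow> three_one a b d e \<Longrightarrow> c = d"
    and three_one_bot: "three_one a b c e \<Longrightarrow> three_one d b c e \<Longrightarrow> a = d"
    and no_Z: "three_one a b c e \<Longrightarrow> three_one b c d f \<Longrightarrow> False"

text \<open>An induced copy requires every pair of vertices to be decided. The pairs left open by
  the assumptions of \<open>rigid_poset\<close> are settled by transitivity, the Ferrers condition
  and the exclusion of 4 + 1.\<close>

lemma rigid_posetI:
  assumes P: "is_poset (X, r)" and io: "interval_order (X, r)" and tf: "twin_free (X, r)"
    and F: "\<forall>Q \<in> forbidden_family. \<not> contains_induced (X, r) Q"
  shows "rigid_poset X r"
proof -
  have sub: "r \<subseteq> X \<times> X" and irr: "\<And>x. (x, x) \<notin> r"
    and tr: "\<And>x y z. (x, y) \<in> r \<Longrightarrow> (y, z) \<in> r \<Longrightarrow> (x, z) \<in> r"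
    using P unfolding is_poset_def by (auto simp: irrefl_def dest: transD)
  obtain I :: "'a \<Rightarrow> real set" where ne: "\<And>x. x \<in> X \<Longrightarrow> I x \<noteq> {}"
    and I: "\<And>x y. x \<in> X \<Longrightarrow> y \<in> X \<Longrightarrow> (x, y) \<in> r \<longleftrightarrow> set_precedes (I x) (I y)"
    using io unfolding interval_order_def by auto
  interpret ferrers_poset X r
  proof (unfold_locales; (fact sub irr tr)?)
    fix x y z w
    assume *: "(x, y) \<in> r" "(z, w) \<in> r" "z \<in> X" "y \<in> X" "(z, y) \<notin> r"
    then have X: "x \<in> X" "w \<in> X"
      using sub by auto
    \<comment> \<open>As \<open>z\<close> does not precede \<open>y\<close>, some point
      \<open>t\<close> of \<open>I y\<close> is at most some point \<open>s\<close> of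
      \<open>I z\<close>. Everything in \<open>I x\<close> is below \<open>t\<close>, and everything
      in \<open>I w\<close> is above \<open>s\<close>.\<close>
    obtain s t where st: "s \<in> I z" "t \<in> I y" "t \<le> s"
      using * I[of z y] by (auto simp: set_precedes_def not_less)
    have "p < q" if "p \<in> I x" "q \<in> I w" for p q
    proof -
      have "p < t" "s < q"
        using * X I st that by (auto simp: set_precedes_def)
      with st show ?thesis by linarith
    qed
    then show "(x, w) \<in> r"
      using I X by (simp add: set_precedes_def)
  qed
  have nc: "\<not> contains_induced (X, r) four_plus_one"
    "\<not> contains_induced (X, r) three_plus_one_plus_one"
    "\<not> contains_induced (X, r) Z_poset"
    "\<not> contains_induced (X, r) Y_poset"
    "\<not> contains_induced (X, r) (dual_poset Y_poset)"
    using F by (auto simp: forbidden_family_def)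
  have lt5: "i \<in> {0, 1, 2, 3, 4}" if "i < length [a, b, c, d, e]" for i and a b c d e :: 'a
    using that by auto
  have lt6: "i \<in> {0, 1, 2, 3, 4, 5}" if "i < length [a, b, c, d, e, f]" for i and a b c d e f :: 'a
    using that by auto
  have no_four_one: False
    if h: "a \<lhd> b" "b \<lhd> c" "c \<lhd> d" "e \<in> X" "\<not> a \<lhd> e" "\<not> e \<lhd> d" for a b c d e
  proof (rule not_contains_induced_list[OF nc(1)[unfolded four_plus_one_def], of "[a, b, c, d, e]"])
    have more: "a \<lhd> c" "a \<lhd> d" "b \<lhd> d" "\<not> e \<lhd> a" "\<not> e \<lhd> b" "\<not> e \<lhd> c" "\<not> b \<lhd> e" "\<not> c \<lhd> e" "\<not> d \<lhd> e"
      using h tr by blast+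
    have rev: "\<not> b \<lhd> a" "\<not> c \<lhd> a" "\<not> d \<lhd> a" "\<not> c \<lhd> b" "\<not> d \<lhd> b" "\<not> d \<lhd> c"
      using h more irr tr by blast+
    show "distinct [a, b, c, d, e]"
      using h more irr by auto
    show "set [a, b, c, d, e] \<subseteq> X"
      using h precD by auto
    show "(i, j) \<in> {(0, 1), (0, 2), (0, 3), (1, 2), (1, 3), (2, 3)} \<longleftrightarrow>
      [a, b, c, d, e] ! i \<lhd> [a, b, c, d, e] ! j"
      if "i < length [a, b, c, d, e]" "j < length [a, b, c, d, e]" for i j
      using lt5[OF that(1)] lt5[OF that(2)] by (elim insertE emptyE; simp add: h more rev irr)
  qed auto
  have isolated: "e = f" if h: "three_one a b c e" "three_one a b c f" for a b c e f
  proof (rule ccontr)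
    assume ne: "e \<noteq> f"
    note d = three_oneD[OF h(1)] three_oneD[OF h(2)]
    \<comment> \<open>Against \<open>a \<lhd> b\<close>, the Ferrers condition would turn
      \<open>e \<lhd> f\<close> into \<open>e \<lhd> b\<close>; the other direction is
      symmetric.\<close>
    have inc: "\<not> e \<lhd> f" "\<not> f \<lhd> e"
      using ferrers[of e f a b] ferrers[of f e a b] d by blast+
    have rev: "\<not> b \<lhd> a" "\<not> c \<lhd> a" "\<not> c \<lhd> b"
      using d irr tr by blast+
    show False
    proof (rule not_contains_induced_list[OF nc(2)[unfolded three_plus_one_plus_one_def],
          of "[a, b, c, e, f]"])
      show "distinct [a, b, c, e, f]"
        using d irr ne by auto
      show "set [a, b, c, e, f] \<subseteq> X"
        using d by auto
      show "(i, j) \<in> {(0, 1), (0, 2), (1, 2)} \<longleftrightarrow> [a, b, c, e, f] ! i \<lhd> [a, b, c, e, f] ! j"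
        if "i < length [a, b, c, e, f]" "j < length [a, b, c, e, f]" for i j
        using lt5[OF that(1)] lt5[OF that(2)] by (elim insertE emptyE; simp add: d inc rev irr)
    qed auto
  qed
  have top: "c = d" if h: "three_one a b c e" "three_one a b d e" for a b c d e
  proof (rule ccontr)
    assume ne: "c \<noteq> d"
    note d = three_oneD[OF h(1)] three_oneD[OF h(2)]
    \<comment> \<open>Comparable tops would lengthen the chain and yield a 4 + 1.\<close>
    have inc: "\<not> c \<lhd> d" "\<not> d \<lhd> c"
      using d no_four_one by blast+
    have rev: "\<not> b \<lhd> a" "\<not> c \<lhd> a" "\<not> c \<lhd> b" "\<not> d \<lhd> a" "\<not> d \<lhd> b"
      using d irr tr by blast+
    show False
    proof (rule not_contains_induced_list[OF nc(4)[unfolded Y_poset_def], of "[a, b, c, d, e]"])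
      show "distinct [a, b, c, d, e]"
        using d irr ne by auto
      show "set [a, b, c, d, e] \<subseteq> X"
        using d by auto
      show "(i, j) \<in> {(0, 1), (0, 2), (0, 3), (1, 2), (1, 3)} \<longleftrightarrow>
        [a, b, c, d, e] ! i \<lhd> [a, b, c, d, e] ! j"
        if "i < length [a, b, c, d, e]" "j < length [a, b, c, d, e]" for i j
        using lt5[OF that(1)] lt5[OF that(2)] by (elim insertE emptyE; simp add: d inc rev irr)
    qed auto
  qed
  have bot: "a = d" if h: "three_one a b c e" "three_one d b c e" for a b c d e
  proof (rule ccontr)
    assume ne: "a \<noteq> d"
    note d = three_oneD[OF h(1)] three_oneD[OF h(2)]
    have inc: "\<not> a \<lhd> d" "\<not> d \<lhd> a"
      using d no_four_one by blast+
    have rev: "\<not> b \<lhd> a" "\<not> c \<lhd> a" "\<not> c \<lhd> b" "\<not> b \<lhd> d" "\<not> c \<lhd> d"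
      using d irr tr by blast+
    show False
    \<comment> \<open>In the dual of Y vertex 0 is the top of the chain and 2, 3 are the minimal
      elements, so the list starts with \<open>c\<close>, \<open>b\<close>.\<close>
    proof (rule not_contains_induced_list[OF nc(5)[unfolded Y_poset_def dual_poset_def fst_conv snd_conv],
          of "[c, b, a, d, e]"])
      show "distinct [c, b, a, d, e]"
        using d irr ne by auto
      show "set [c, b, a, d, e] \<subseteq> X"
        using d by auto
      show "(i, j) \<in> {(0, 1), (0, 2), (0, 3), (1, 2), (1, 3)}\<inverse> \<longleftrightarrow>
        [c, b, a, d, e] ! i \<lhd> [c, b, a, d, e] ! j"
        if "i < length [c, b, a, d, e]" "j < length [c, b, a, d, e]" for i j
        using lt5[OF that(1)] lt5[OF that(2)] by (elim insertE emptyE; simp add: d inc rev irr)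
    qed auto
  qed
  have Z: False if h: "three_one a b c e" "three_one b c d f" for a b c d e f
  proof -
    note d = three_oneD[OF h(1)] three_oneD[OF h(2)]
    have ad: "a \<lhd> d"
      using d tr by blast
    \<comment> \<open>Otherwise \<open>e\<close> would be isolated from the 4-chain
      \<open>a\<close>, \<open>b\<close>, \<open>c\<close>, \<open>d\<close>; the same argument
      gives \<open>a \<lhd> f\<close>.\<close>
    have ed: "e \<lhd> d"
      using d no_four_one[of a b c d e] by blast
    have af: "a \<lhd> f"
      using d no_four_one[of a b c d f] by blast
    have inc: "\<not> e \<lhd> f" "\<not> f \<lhd> e"
      using ferrers[of e f b c] d tr[OF af] by blast+
    have rev: "\<not> b \<lhd> a" "\<not> c \<lhd> a" "\<not> c \<lhd> b" "\<not> d \<lhd> a" "\<not> d \<lhd> b" "\<not> d \<lhd> c" "\<not> d \<lhd> e" "\<not> f \<lhd> a"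
      using d ad ed af irr tr by blast+
    show False
    proof (rule not_contains_induced_list[OF nc(3)[unfolded Z_poset_def], of "[a, b, c, d, e, f]"])
      show "distinct [a, b, c, d, e, f]"
        using d ad ed af irr by auto
      show "set [a, b, c, d, e, f] \<subseteq> X"
        using d by auto
      show "(i, j) \<in> {(0, 1), (0, 2), (0, 3), (1, 2), (1, 3), (2, 3), (4, 3), (0, 5)} \<longleftrightarrow>
        [a, b, c, d, e, f] ! i \<lhd> [a, b, c, d, e, f] ! j"
        if "i < length [a, b, c, d, e, f]" "j < length [a, b, c, d, e, f]" for i j
        using lt6[OF that(1)] lt6[OF that(2)] by (elim insertE emptyE; simp add: d ad ed af inc rev irr)
    qed auto
  qed
  have twin: "x = y" if "x \<in> X" "y \<in> X" "\<And>z. z \<lhd> x \<longleftrightarrow> z \<lhd> y" "\<And>z. x \<lhd> z \<longleftrightarrow> y \<lhd> z" for x y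
    using tf that unfolding twin_free_def twins_def by auto
  show ?thesis
    by unfold_locales (fact twin no_four_one isolated top bot Z)+
qed

text \<open>Reversal exchanges \<open>three_one_top\<close> with \<open>three_one_bot\<close> and
  preserves the other assumptions. Statements about bottoms and left sides thus follow from those
  about tops and right sides.\<close>

lemma rigid_poset_dual:
  assumes "rigid_poset X r"
  shows "rigid_poset X (r\<inverse>)"
proof -
  interpret rigid_poset X r by fact
  interpret dual: ferrers_poset X "r\<inverse>"
    by (rule ferrers_poset_dual) unfold_locales
  have eq: "dual.three_one a b c e \<longleftrightarrow> three_one c b a e" for a b c e
    unfolding dual.three_one_def three_one_def by auto
  show ?thesis
  proof
    show "x = y" if "x \<in> X" "y \<in> X" "\<And>z. (z, x) \<in> r\<inverse> \<longleftrightarrow> (z, y) \<in> r\<inverse>"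
      "\<And>z. (x, z) \<in> r\<inverse> \<longleftrightarrow> (y, z) \<in> r\<inverse>" for x y
      using that twin by simp
    show False if "(a, b) \<in> r\<inverse>" "(b, c) \<in> r\<inverse>" "(c, d) \<in> r\<inverse>" "e \<in> X" "(a, e) \<notin> r\<inverse>" "(e, d) \<notin> r\<inverse>"
      for a b c d e
      using no_four_one[of d c b a e] that by simp
    show "e = f" if "dual.three_one a b c e" "dual.three_one a b c f" for a b c e f
      using that unfolding eq by (rule three_one_isolated)
    show "c = d" if "dual.three_one a b c e" "dual.three_one a b d e" for a b c d e
      using that unfolding eq by (rule three_one_bot)
    show "a = d" if "dual.three_one a b c e" "dual.three_one d b c e" for a b c d e
      using that unfolding eq by (rule three_one_top)
    show False if "dual.three_one a b c e" "dual.three_one b c d f" for a b c d e f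
      using that(2,1) unfolding eq by (rule no_Z)
  qed
qed

section \<open>Uniqueness of the 3 + 1 around a middle element\<close>

context rigid_poset
begin

lemma rigid_dual: "rigid_poset X (r\<inverse>)"
  by (rule rigid_poset_dual) unfold_locales

lemma dual_three_one: "ferrers_poset.three_one X (r\<inverse>) a b c e \<longleftrightarrow> three_one c b a e"
proof -
  interpret dual: rigid_poset X "r\<inverse>" by (rule rigid_dual)
  show ?thesis
    unfolding dual.three_one_def three_one_def by auto
qed

text \<open>The Ferrers condition forbids having both \<open>a \<lhd> e'\<close> and
  \<open>a' \<lhd> e\<close>, and likewise both \<open>e \<lhd> c'\<close> and
  \<open>e' \<lhd> c\<close>. Hence parts of the two configurations can be exchanged to form further
  ones around \<open>b\<close>, which conflict with \<open>three_one_isolated\<close> or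
  \<open>three_one_top\<close>.\<close>

lemma three_one_isolated_unique:
  assumes 1: "three_one a b c e" and 2: "three_one a' b c' e'"
  shows "e = e'"
proof (rule ccontr)
  assume ne: "e \<noteq> e'"
  \<comment> \<open>Generalized over both configurations so that it also covers
    \<open>a \<lhd> e'\<close>, with the roles exchanged.\<close>
  have *: False if h: "three_one a b c e" "three_one a' b c' e'" "e \<noteq> e'" "a' \<lhd> e"
    for a c e a' c' e'
  proof -
    note d = three_oneD[OF h(1)] three_oneD[OF h(2)]
    have ae': "\<not> a \<lhd> e'"
      using ferrers[of a e' a' e] h d by blast
    show False
    proof (cases "e' \<lhd> c")
      case True
      then have "\<not> e \<lhd> c'"
        using ferrers[of e c' e' c] d by blast
      then have "c = c'"
        using three_one_top[of a b c e c'] d by (simp add: three_one_def)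
      with True d show False by blast
    next
      case False
      then have "three_one a b c e'"
        using d ae' by (simp add: three_one_def)
      with h three_one_isolated show False by blast
    qed
  qed
  show False
  proof (cases "a' \<lhd> e")
    case True
    with * 1 2 ne show False by blast
  next
    case False
    show False
    proof (cases "a \<lhd> e'")
      case True
      with * 1 2 ne show False by blast
    next
      case False': False
      note d = three_oneD[OF 1] three_oneD[OF 2]
      have "three_one a b c' e'" "three_one a' b c e"
        using d False False' by (simp_all add: three_one_def)
      then have "\<not> three_one a b c' e"
        using ne three_one_isolated by blast
      then have "e \<lhd> c'"
        using d by (simp add: three_one_def)
      then have "\<not> e' \<lhd> c"
        using ferrers[of e' c e c'] d by blast
      then have "three_one a b c e'"
        using d False' by (simp add: three_one_def)
      then show False
        using 1 ne three_one_isolated by blast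
    qed
  qed
qed

text \<open>Once the isolated elements agree, bottoms and tops can be combined freely, so
  \<open>three_one_top\<close> and \<open>three_one_bot\<close> apply.\<close>

lemma three_one_unique:
  assumes "three_one a b c e" "three_one a' b c' e'"
  shows "a = a'" "c = c'" "e = e'"
proof -
  show e: "e = e'"
    using assms three_one_isolated_unique by blast
  then have "three_one a b c' e"
    using assms by (simp add: three_one_def)
  then show "c = c'" "a = a'"
    using assms e three_one_top three_one_bot by blast+
qed

definition middle :: "'a set" where
  "middle = {b. \<exists>a c e. three_one a b c e}"

text \<open>If \<open>e\<close> were the middle of \<open>a'\<close>, \<open>e\<close>,
  \<open>c'\<close> with isolated \<open>g\<close>, the Ferrers condition would put \<open>b\<close>
  between \<open>a'\<close> and \<open>c'\<close> too. Uniqueness around \<open>b\<close> then gives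
  \<open>g = e\<close>, which is absurd since \<open>a' \<lhd> e\<close>.\<close>

lemma isolated_not_middle:
  assumes "three_one a b c e"
  shows "e \<notin> middle"
proof
  assume "e \<in> middle"
  then obtain a' c' g where 2: "three_one a' e c' g"
    by (auto simp: middle_def)
  note d = three_oneD[OF assms] three_oneD[OF 2]
  have "a' \<lhd> b" "b \<lhd> c'"
    using ferrers[of a' e a b] ferrers[of b c e c'] d by blast+
  then have "three_one a' b c' g"
    using d by (simp add: three_one_def)
  then have "g = e"
    using assms by (rule three_one_unique(3))
  with d show False by blast
qed

text \<open>If \<open>c\<close> were the middle of \<open>a'\<close>, \<open>c\<close>,
  \<open>d\<close> with isolated \<open>f\<close>, excluding Z gives \<open>b \<lhd> f\<close>. As
  \<open>f\<close> is not the unique top \<open>c\<close>, also \<open>e \<lhd> f\<close>, and the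
  Ferrers condition yields \<open>e \<lhd> c\<close>.\<close>

lemma top_not_middle:
  assumes "three_one a b c e"
  shows "c \<notin> middle"
proof
  assume "c \<in> middle"
  then obtain a' d f where 2: "three_one a' c d f"
    by (auto simp: middle_def)
  note d = three_oneD[OF assms] three_oneD[OF 2]
  have bf: "b \<lhd> f"
    using no_Z[OF assms, of d f] d by (auto simp: three_one_def)
  have "\<not> three_one a b f e"
    using three_one_unique[OF assms] d by blast
  then have "e \<lhd> f"
    using d bf by (simp add: three_one_def)
  then show False
    using ferrers[of e f a' c] d by blast
qed

lemma bot_not_middle:
  assumes "three_one a b c e"
  shows "a \<notin> middle"
proof -
  interpret dual: rigid_poset X "r\<inverse>" by (rule rigid_dual)
  show ?thesis
    using dual.top_not_middle[of c b a e] assms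
    by (simp add: dual.middle_def middle_def dual_three_one)
qed

section \<open>The linear order of the non-middle elements\<close>

definition before :: "'a \<Rightarrow> 'a \<Rightarrow> bool" (infix "\<sqsubset>" 50) where
  "x \<sqsubset> y \<longleftrightarrow> x \<noteq> y \<and> (\<forall>z. z \<lhd> x \<longrightarrow> z \<lhd> y) \<and> (\<forall>z. y \<lhd> z \<longrightarrow> x \<lhd> z)"

lemma beforeD: "x \<sqsubset> y \<Longrightarrow> z \<lhd> x \<Longrightarrow> z \<lhd> y" "x \<sqsubset> y \<Longrightarrow> y \<lhd> z \<Longrightarrow> x \<lhd> z"
  by (auto simp: before_def)

text \<open>Inclusions in both directions would make \<open>x\<close> and \<open>y\<close> twins.
  Since all of \<open>X\<close> is inspected, elements that only middle elements distinguish are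
  separated as well.\<close>

lemma before_asym:
  assumes "x \<in> X" "y \<in> X" "x \<sqsubset> y"
  shows "\<not> y \<sqsubset> x"
proof
  assume "y \<sqsubset> x"
  then have "z \<lhd> x \<longleftrightarrow> z \<lhd> y" "x \<lhd> z \<longleftrightarrow> y \<lhd> z" for z
    using assms(3) beforeD by blast+
  then have "x = y"
    by (intro twin assms)
  with assms(3) show False by (simp add: before_def)
qed

lemma before_trans:
  assumes "x \<in> X" "y \<in> X" "x \<sqsubset> y" "y \<sqsubset> z"
  shows "x \<sqsubset> z"
proof -
  have "x \<noteq> z"
    using before_asym assms by blast
  then show ?thesis
    using assms unfolding before_def by blast
qed

lemma not_before_cases:
  assumes "x \<in> X" "y \<in> X" "x \<noteq> y" "\<not> x \<sqsubset> y"
  shows "(\<exists>z. z \<lhd> x \<and> \<not> z \<lhd> y) \<or> (\<exists>z. y \<lhd> z \<and> \<not> x \<lhd> z)"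
  using assms unfolding before_def by blast

text \<open>Two ways to fail are crossing predecessors or crossing successors, both excluded by the
  Ferrers condition. In the other two, one element has an extra predecessor and an extra successor,
  which makes it the middle of a 3 + 1 whose isolated element is the other.\<close>

lemma before_total:
  assumes "x \<in> X - middle" "y \<in> X - middle" "x \<noteq> y"
  shows "x \<sqsubset> y \<or> y \<sqsubset> x"
proof (rule ccontr)
  assume neg: "\<not> ?thesis"
  have mid: "\<not> (\<exists>p s. p \<lhd> y \<and> \<not> p \<lhd> x \<and> y \<lhd> s \<and> \<not> x \<lhd> s)"
    "\<not> (\<exists>p s. p \<lhd> x \<and> \<not> p \<lhd> y \<and> x \<lhd> s \<and> \<not> y \<lhd> s)"
    using assms unfolding middle_def three_one_def by blast+
  have ch: "\<not> (z \<lhd> x \<and> \<not> z \<lhd> y \<and> w \<lhd> y \<and> \<not> w \<lhd> x)"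
    "\<not> (x \<lhd> z \<and> \<not> y \<lhd> z \<and> y \<lhd> w \<and> \<not> x \<lhd> w)" for z w
    using ferrers[of z x w y] ferrers[of x z y w] assms precD by blast+
  have "(\<exists>z. z \<lhd> x \<and> \<not> z \<lhd> y) \<or> (\<exists>z. y \<lhd> z \<and> \<not> x \<lhd> z)"
    "(\<exists>z. z \<lhd> y \<and> \<not> z \<lhd> x) \<or> (\<exists>z. x \<lhd> z \<and> \<not> y \<lhd> z)"
    using not_before_cases[of x y] not_before_cases[of y x] assms neg by auto
  then show False
    using mid ch by blast
qed

text \<open>The pairs (bottom, isolated) and (isolated, top) of a 3 + 1: closed intervals that have
  to share an endpoint.\<close>

definition touch :: "'a \<Rightarrow> 'a \<Rightarrow> bool" where
  "touch x y \<longleftrightarrow> (\<exists>b z. three_one x b z y) \<or> (\<exists>z b. three_one z b y x)"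

lemma touch_not_prec: "touch x y \<Longrightarrow> \<not> x \<lhd> y"
  unfolding touch_def three_one_def by blast

text \<open>The middle \<open>b\<close> refutes \<open>y \<sqsubset> x\<close>: it is above the
  bottom and below the top, but incomparable to the isolated element. Totality does the
  rest.\<close>

lemma touch_before:
  assumes "touch x y" "x \<in> X - middle" "y \<in> X - middle"
  shows "x \<sqsubset> y"
proof -
  have "x \<noteq> y" "\<not> y \<sqsubset> x"
    using assms(1) unfolding touch_def by (auto dest: three_oneD beforeD)
  then show ?thesis
    using before_total assms by blast
qed

lemma prec_before: "x \<lhd> y \<Longrightarrow> x \<sqsubset> y"
  using tr[of _ x y] tr[of x y] irr by (auto simp: before_def)

text \<open>If \<open>x \<lhd> z\<close> failed, \<open>z\<close> could replace \<open>y\<close> in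
  the 3 + 1 that witnesses the touching, against uniqueness.\<close>

lemma touch_before_right:
  assumes "touch x y" "y \<sqsubset> z" "z \<in> X"
  shows "x \<lhd> z"
proof (rule ccontr)
  assume neg: "\<not> x \<lhd> z"
  from assms(1) consider b c where "three_one x b c y" | a b where "three_one a b y x"
    unfolding touch_def by blast
  then show False
  proof cases
    case 1
    note d = three_oneD[OF 1]
    have "three_one x b c z"
      using d neg assms(3) beforeD(2)[OF assms(2)] by (auto simp: three_one_def)
    then show False
      using three_one_unique(3)[OF 1] assms(2) by (metis before_def)
  next
    case 2
    note d = three_oneD[OF 2]
    have "three_one a b z x"
      using d neg beforeD(1)[OF assms(2) d(2)] by (simp add: three_one_def)
    then show False
      using three_one_unique(2)[OF 2] assms(2) by (metis before_def)
  qed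
qed

lemma touch_before_left:
  assumes "touch x y" "z \<sqsubset> x" "z \<in> X"
  shows "z \<lhd> y"
proof -
  interpret dual: rigid_poset X "r\<inverse>" by (rule rigid_dual)
  have "dual.touch y x" "dual.before x z"
    using assms by (auto simp: dual.touch_def touch_def dual_three_one dual.before_def before_def)
  then show ?thesis
    using dual.touch_before_right assms by blast
qed

text \<open>An element below \<open>b\<close> but after \<open>a\<close> could replace
  \<open>a\<close> as the bottom, against uniqueness. In a model this reads: \<open>x\<close>
  precedes \<open>b\<close> exactly if its left endpoint is at most that of
  \<open>a\<close>.\<close>

lemma prec_middle_iff:
  assumes b: "three_one a b c e" and x: "x \<in> X - middle"
  shows "x \<lhd> b \<longleftrightarrow> \<not> a \<sqsubset> x"
proof
  note d = three_oneD[OF b]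
  assume xb: "x \<lhd> b"
  show "\<not> a \<sqsubset> x"
  proof
    assume ax: "a \<sqsubset> x"
    have "\<not> x \<lhd> e"
      using beforeD(2)[OF ax] d by blast
    then have "three_one x b c e"
      using d xb by (simp add: three_one_def)
    then show False
      using three_one_unique(1)[OF b] ax by (metis before_def)
  qed
next
  note d = three_oneD[OF b]
  assume "\<not> a \<sqsubset> x"
  then have "x = a \<or> x \<sqsubset> a"
    using before_total[of x a] x d bot_not_middle[OF b] by blast
  then show "x \<lhd> b"
    using d beforeD(2) by blast
qed

lemma middle_prec_iff:
  assumes b: "three_one a b c e" and x: "x \<in> X - middle"
  shows "b \<lhd> x \<longleftrightarrow> \<not> x \<sqsubset> c"
proof -
  interpret dual: rigid_poset X "r\<inverse>" by (rule rigid_dual)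
  have "dual.middle = middle"
    unfolding dual.middle_def middle_def dual_three_one by blast
  moreover have "dual.before c x \<longleftrightarrow> x \<sqsubset> c"
    by (auto simp: dual.before_def before_def)
  ultimately show ?thesis
    using dual.prec_middle_iff[of c b a e x] assms by (simp add: dual_three_one)
qed

text \<open>Reduces two middle elements to one: if \<open>b \<lhd> b'\<close> without
  \<open>b \<lhd> e'\<close>, then \<open>b\<close> would be the bottom of a 3 + 1 around
  \<open>b'\<close>, but bottoms are not middle.\<close>

lemma middle_prec_middle_iff:
  assumes b: "three_one a b c e" and b': "three_one a' b' c' e'"
  shows "b \<lhd> b' \<longleftrightarrow> b \<lhd> e'"
proof
  note d = three_oneD[OF b'] three_oneD[OF b]
  show "b \<lhd> b'" if "b \<lhd> e'"
    using ferrers[of b e' a' b'] d that by blast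
  show "b \<lhd> e'" if "b \<lhd> b'"
  proof (rule ccontr)
    assume "\<not> b \<lhd> e'"
    then have "three_one b b' c' e'"
      using d that by (simp add: three_one_def)
    then show False
      using bot_not_middle b by (auto simp: middle_def)
  qed
qed

end

section \<open>Placing closed unit intervals\<close>

lemma exists_between_finite:
  fixes A B :: "real set"
  assumes "finite A" "finite B" "\<And>a b. a \<in> A \<Longrightarrow> b \<in> B \<Longrightarrow> a < b"
  shows "\<exists>v. (\<forall>a \<in> A. a < v) \<and> (\<forall>b \<in> B. v < b)"
proof (cases "A = {} \<or> B = {}")
  case True
  then show ?thesis
    using assms(1,2)
    by (metis Max_less_iff Min_gr_iff empty_iff gt_ex lt_ex)
next
  case False
  then have "Max A < Min B"
    using assms by simp
  then obtain v where "Max A < v" "v < Min B"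
    using dense by blast
  then show ?thesis
    using assms False by auto
qed

text \<open>\<open>S\<close> prescribes a distance above 1 and \<open>W\<close> a distance of at
  least 1, so pairs in \<open>W\<close> but not in \<open>S\<close> touch. The last two hypotheses
  say that moving either end of a \<open>W\<close> pair outward gives an \<open>S\<close> pair. By
  induction, only the \<open>lt\<close>-greatest element \<open>m\<close> has to be placed.\<close>

lemma unit_placement:
  fixes lt S W :: "'a \<Rightarrow> 'a \<Rightarrow> bool"
  assumes "finite Q"
    and "\<And>x y. x \<in> Q \<Longrightarrow> y \<in> Q \<Longrightarrow> lt x y \<Longrightarrow> \<not> lt y x"
    and "\<And>x y z. x \<in> Q \<Longrightarrow> y \<in> Q \<Longrightarrow> z \<in> Q \<Longrightarrow> lt x y \<Longrightarrow> lt y z \<Longrightarrow> lt x z"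
    and "\<And>x y. x \<in> Q \<Longrightarrow> y \<in> Q \<Longrightarrow> x \<noteq> y \<Longrightarrow> lt x y \<or> lt y x"
    and "\<And>x y. x \<in> Q \<Longrightarrow> y \<in> Q \<Longrightarrow> S x y \<Longrightarrow> W x y"
    and "\<And>x y. x \<in> Q \<Longrightarrow> y \<in> Q \<Longrightarrow> W x y \<Longrightarrow> lt x y"
    and "\<And>x y z. x \<in> Q \<Longrightarrow> y \<in> Q \<Longrightarrow> z \<in> Q \<Longrightarrow> W x y \<Longrightarrow> lt y z \<Longrightarrow> S x z"
    and "\<And>x y z. x \<in> Q \<Longrightarrow> y \<in> Q \<Longrightarrow> z \<in> Q \<Longrightarrow> W x y \<Longrightarrow> lt z x \<Longrightarrow> S z y"
  shows "\<exists>l :: 'a \<Rightarrow> real. \<forall>x \<in> Q. \<forall>y \<in> Q. (lt x y \<longleftrightarrow> l x < l y) \<and>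
    (S x y \<longleftrightarrow> l x + 1 < l y) \<and> (W x y \<longleftrightarrow> l x + 1 \<le> l y)"
  using assms
proof (induction "card Q" arbitrary: Q)
  case 0
  then have "Q = {}"
    using card_eq_0_iff by metis
  then show ?case by simp
next
  case (Suc n)
  note fin = Suc.prems(1) and asym = Suc.prems(2) and trans = Suc.prems(3)
    and total = Suc.prems(4) and SW = Suc.prems(5) and Wlt = Suc.prems(6)
    and right = Suc.prems(7) and left = Suc.prems(8)
  have "\<exists>m \<in> Q. \<forall>x \<in> Q. x \<noteq> m \<longrightarrow> \<not> lt m x"
  proof (rule Finite_Set.bex_max_element)
    show "finite Q" by (fact fin)
    show "Q \<noteq> {}" using Suc.hyps(2) by auto
    show "asymp_on Q lt" using asym by (auto intro: asymp_onI)
    show "transp_on Q lt" using trans by (auto intro: transp_onI)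
  qed
  then obtain m where m: "m \<in> Q" and max: "\<forall>x \<in> Q. x \<noteq> m \<longrightarrow> \<not> lt m x"
    by blast
  have mx: "\<not> lt m x" if "x \<in> Q" for x
    using that max asym[OF m m] by (cases "x = m") auto
  define Q' where "Q' = Q - {m}"
  have Q': "x \<in> Q" "x \<noteq> m" "lt x m" if "x \<in> Q'" for x
    using that total[of x m] m mx by (auto simp: Q'_def)
  have "n = card Q'"
    using Suc.hyps(2) m fin by (simp add: Q'_def)
  then have "\<exists>l :: 'a \<Rightarrow> real. \<forall>x \<in> Q'. \<forall>y \<in> Q'. (lt x y \<longleftrightarrow> l x < l y) \<and>
    (S x y \<longleftrightarrow> l x + 1 < l y) \<and> (W x y \<longleftrightarrow> l x + 1 \<le> l y)"
  proof (rule Suc.hyps(1))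
    show "finite Q'" using fin by (simp add: Q'_def)
    show "\<not> lt y x" if "x \<in> Q'" "y \<in> Q'" "lt x y" for x y
      using that Q'(1) asym by blast
    show "lt x z" if "x \<in> Q'" "y \<in> Q'" "z \<in> Q'" "lt x y" "lt y z" for x y z
      using that Q'(1) trans by blast
    show "lt x y \<or> lt y x" if "x \<in> Q'" "y \<in> Q'" "x \<noteq> y" for x y
      using that Q'(1) total by blast
    show "W x y" if "x \<in> Q'" "y \<in> Q'" "S x y" for x y
      using that Q'(1) SW by blast
    show "lt x y" if "x \<in> Q'" "y \<in> Q'" "W x y" for x y
      using that Q'(1) Wlt by blast
    show "S x z" if "x \<in> Q'" "y \<in> Q'" "z \<in> Q'" "W x y" "lt y z" for x y z
      using that Q'(1) right by blast
    show "S z y" if "x \<in> Q'" "y \<in> Q'" "z \<in> Q'" "W x y" "lt z x" for x y z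
      using that Q'(1) left by blast
  qed
  then obtain l :: "'a \<Rightarrow> real" where
    l: "\<And>x y. x \<in> Q' \<Longrightarrow> y \<in> Q' \<Longrightarrow> lt x y \<longleftrightarrow> l x < l y"
      "\<And>x y. x \<in> Q' \<Longrightarrow> y \<in> Q' \<Longrightarrow> S x y \<longleftrightarrow> l x + 1 < l y"
      "\<And>x y. x \<in> Q' \<Longrightarrow> y \<in> Q' \<Longrightarrow> W x y \<longleftrightarrow> l x + 1 \<le> l y"
    by blast
  \<comment> \<open>If \<open>W y x\<close> held, \<open>m\<close>, lying after \<open>x\<close>,
    would satisfy \<open>S y m\<close>.\<close>
  have lW: "l x < l y + 1" if "x \<in> Q'" "y \<in> Q'" "\<not> S y m" for x y
  proof -
    have "\<not> W y x"
      using right[of y x m] that Q' m by blast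
    then show ?thesis
      using l(3) that by force
  qed
  have "\<exists>v. (\<forall>x \<in> Q'. l x < v \<and> (S x m \<longleftrightarrow> l x + 1 < v) \<and> (W x m \<longleftrightarrow> l x + 1 \<le> v))"
  proof (cases "\<exists>x \<in> Q'. W x m \<and> \<not> S x m")
    case True
    then obtain t where t: "t \<in> Q'" "W t m" "\<not> S t m"
      by blast
    \<comment> \<open>Touching \<open>t\<close> forces the position \<open>l t + 1\<close>. Elements
      before \<open>t\<close> are then in relation \<open>S\<close> to \<open>m\<close>, and
      elements after \<open>t\<close> are not even in relation \<open>W\<close>.\<close>
    have "l x < l t + 1 \<and> (S x m \<longleftrightarrow> l x < l t) \<and> (W x m \<longleftrightarrow> l x \<le> l t)" if x: "x \<in> Q'" for x
    proof -
      consider "x = t" | "lt x t" | "lt t x"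
        using total Q' x t by blast
      then show ?thesis
      proof cases
        case 1
        then show ?thesis using t by simp
      next
        case 2
        then have "S x m" "W x m" "l x < l t"
          using left[of t m x] SW Q' x t m l(1) by blast+
        then show ?thesis by simp
      next
        case 3
        then have "\<not> W x m" "\<not> S x m" "l t < l x"
          using left[of x m t] SW Q' x t m l(1) by blast+
        then show ?thesis using lW[OF x t(1,3)] by simp
      qed
    qed
    then show ?thesis
      by (intro exI[of _ "l t + 1"]) simp
  next
    case False
    \<comment> \<open>Here \<open>W x m\<close> and \<open>S x m\<close> agree, so all constraints
      on \<open>v\<close> are strict: \<open>?A\<close> collects the lower and \<open>?B\<close> the
      upper bounds.\<close>
    let ?A = "l ` Q' \<union> (\<lambda>x. l x + 1) ` {x \<in> Q'. W x m}"
    let ?B = "(\<lambda>x. l x + 1) ` {x \<in> Q'. \<not> W x m}"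
    have finQ': "finite Q'"
      using fin by (simp add: Q'_def)
    have "l x < l y" if "x \<in> Q'" "y \<in> Q'" "W x m" "\<not> W y m" for x y
    proof -
      have "\<not> lt y x" "x \<noteq> y"
        using left[of x m y] that Q' SW m by blast+
      then show ?thesis
        using total l(1) Q' that by blast
    qed
    moreover have "l x < l y + 1" if "x \<in> Q'" "y \<in> Q'" "\<not> W y m" for x y
      using lW[of x y] SW[of y m] that Q'(1) m by blast
    ultimately have "a < b" if "a \<in> ?A" "b \<in> ?B" for a b
      using that by auto
    then obtain v where v: "\<forall>a \<in> ?A. a < v" "\<forall>b \<in> ?B. v < b"
      using exists_between_finite[of ?A ?B] finQ' by auto
    have "l x < v \<and> (S x m \<longleftrightarrow> l x + 1 < v) \<and> (W x m \<longleftrightarrow> l x + 1 \<le> v)" if x: "x \<in> Q'" for x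
    proof (cases "W x m")
      case True
      then have "S x m" "l x + 1 < v"
        using v(1) x False by auto
      with True show ?thesis by simp
    next
      case nW: False
      then have "\<not> S x m"
        using SW[of x m] Q'(1)[OF x] m by blast
      moreover have "l x < v" "v < l x + 1"
        using v x nW by auto
      ultimately show ?thesis
        using nW by simp
    qed
    then show ?thesis by blast
  qed
  then obtain v where v: "\<And>x. x \<in> Q' \<Longrightarrow> l x < v" "\<And>x. x \<in> Q' \<Longrightarrow> S x m \<longleftrightarrow> l x + 1 < v"
    "\<And>x. x \<in> Q' \<Longrightarrow> W x m \<longleftrightarrow> l x + 1 \<le> v"
    by blast
  have mS: "\<not> W m x" "\<not> S m x" if "x \<in> Q" for x
    using mx[OF that] Wlt[OF m that] SW[OF m that] by blast+
  have "(lt x y \<longleftrightarrow> (l(m := v)) x < (l(m := v)) y) \<and>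
    (S x y \<longleftrightarrow> (l(m := v)) x + 1 < (l(m := v)) y) \<and>
    (W x y \<longleftrightarrow> (l(m := v)) x + 1 \<le> (l(m := v)) y)" if xy: "x \<in> Q" "y \<in> Q" for x y
  proof -
    consider "x = m" "y = m" | "x = m" "y \<in> Q'" | "x \<in> Q'" "y = m" | "x \<in> Q'" "y \<in> Q'"
      using xy by (auto simp: Q'_def)
    then show ?thesis
    proof cases
      case 1
      then show ?thesis using mx mS m by simp
    next
      case 2
      then show ?thesis using mx mS v(1)[of y] Q'[of y] by simp
    next
      case 3
      then show ?thesis using v Q'[of x] by simp
    next
      case 4
      then show ?thesis using l Q'(2)[of x] Q'(2)[of y] by simp
    qed
  qed
  then show ?case by blast
qed

section \<open>From the placement to an endpoint model\<close>

lemma (in rigid_poset) ex_endpoint_model: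
  assumes fin: "finite X"
  shows "\<exists>l opn len. endpoint_model (X, r) l opn len"
proof -
  let ?Q = "X - middle"
  \<comment> \<open>\<open>unit_placement\<close> is used with \<open>\<lhd>\<close> as
    \<open>S\<close> and its union with \<open>touch\<close> as \<open>W\<close>; a touching pair is
    not in \<open>\<lhd>\<close> and so gets distance exactly 1.\<close>
  have "\<exists>l :: 'a \<Rightarrow> real. \<forall>x \<in> ?Q. \<forall>y \<in> ?Q. (x \<sqsubset> y \<longleftrightarrow> l x < l y) \<and>
    (x \<lhd> y \<longleftrightarrow> l x + 1 < l y) \<and> ((x \<lhd> y \<or> touch x y) \<longleftrightarrow> l x + 1 \<le> l y)"
  proof (rule unit_placement)
    show "finite ?Q" using fin by simp
    show "\<not> y \<sqsubset> x" if "x \<in> ?Q" "y \<in> ?Q" "x \<sqsubset> y" for x y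
      using that before_asym by blast
    show "x \<sqsubset> z" if "x \<in> ?Q" "y \<in> ?Q" "z \<in> ?Q" "x \<sqsubset> y" "y \<sqsubset> z" for x y z
      using that before_trans by blast
    show "x \<sqsubset> y \<or> y \<sqsubset> x" if "x \<in> ?Q" "y \<in> ?Q" "x \<noteq> y" for x y
      using that before_total by blast
    show "x \<sqsubset> y" if "x \<in> ?Q" "y \<in> ?Q" "x \<lhd> y \<or> touch x y" for x y
      using that touch_before prec_before by blast
    show "x \<lhd> z" if "x \<in> ?Q" "y \<in> ?Q" "z \<in> ?Q" "x \<lhd> y \<or> touch x y" "y \<sqsubset> z" for x y z
      using that touch_before_right beforeD(1) by blast
    show "z \<lhd> y" if "x \<in> ?Q" "y \<in> ?Q" "z \<in> ?Q" "x \<lhd> y \<or> touch x y" "z \<sqsubset> x" for x y z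
      using that touch_before_left beforeD(2) by blast
  qed blast
  then obtain l :: "'a \<Rightarrow> real" where
    l: "\<And>x y. x \<in> ?Q \<Longrightarrow> y \<in> ?Q \<Longrightarrow> x \<sqsubset> y \<longleftrightarrow> l x < l y"
      "\<And>x y. x \<in> ?Q \<Longrightarrow> y \<in> ?Q \<Longrightarrow> x \<lhd> y \<longleftrightarrow> l x + 1 < l y"
      "\<And>x y. x \<in> ?Q \<Longrightarrow> y \<in> ?Q \<Longrightarrow> (x \<lhd> y \<or> touch x y) \<longleftrightarrow> l x + 1 \<le> l y"
    by blast
  have "\<forall>b \<in> middle. \<exists>a c e. three_one a b c e"
    by (auto simp: middle_def)
  then obtain lo hi enc where enc: "\<And>b. b \<in> middle \<Longrightarrow> three_one (lo b) b (hi b) (enc b)"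
    by metis
  have Q: "lo b \<in> ?Q" "hi b \<in> ?Q" "enc b \<in> ?Q" if "b \<in> middle" for b
    using bot_not_middle[OF enc[OF that]] top_not_middle[OF enc[OF that]]
      isolated_not_middle[OF enc[OF that]] three_oneD[OF enc[OF that]] by simp_all
  have eq: "l (enc b) = l (lo b) + 1" "l (hi b) = l (enc b) + 1" if "b \<in> middle" for b
  proof -
    have t: "touch (lo b) (enc b)" "touch (enc b) (hi b)"
      using enc[OF that] unfolding touch_def by blast+
    show "l (enc b) = l (lo b) + 1"
      using t(1) touch_not_prec[OF t(1)] l(2,3)[of "lo b" "enc b"] Q[OF that] by force
    show "l (hi b) = l (enc b) + 1"
      using t(2) touch_not_prec[OF t(2)] l(2,3)[of "enc b" "hi b"] Q[OF that] by force
  qed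
  define l' where "l' x = (if x \<in> middle then l (enc x) else l x)" for x
  \<comment> \<open>Not being after \<open>lo b\<close> means \<open>l x \<le> l (lo b)\<close>, and
    \<open>lo b\<close> lies exactly 1 to the left of \<open>enc b\<close>. The non-strict bound is
    the rule for the open element \<open>b\<close>.\<close>
  have Qm: "x \<lhd> b \<longleftrightarrow> l x + 1 \<le> l (enc b)" if "x \<in> ?Q" "b \<in> middle" for x b
    using prec_middle_iff[OF enc that(1)] that l(1)[of "lo b" x] Q[OF that(2)] eq(1)[OF that(2)]
    by auto
  have mQ: "b \<lhd> x \<longleftrightarrow> l (enc b) + 1 \<le> l x" if "x \<in> ?Q" "b \<in> middle" for x b
    using middle_prec_iff[OF enc that(1)] that l(1)[of x "hi b"] Q[OF that(2)] eq(2)[OF that(2)]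
    by auto
  have mm: "b \<lhd> b' \<longleftrightarrow> l (enc b) + 1 \<le> l (enc b')" if "b \<in> middle" "b' \<in> middle" for b b'
    using middle_prec_middle_iff[OF enc enc] mQ[of "enc b'" b] that Q by blast
  have "endpoint_model (X, r) l' (\<lambda>x. x \<in> middle) 1"
    unfolding endpoint_model_def fst_conv snd_conv
  proof (intro conjI ballI)
    fix x y assume "x \<in> X" "y \<in> X"
    then show "x \<lhd> y \<longleftrightarrow> l' x + 1 < l' y \<or> (l' x + 1 = l' y \<and> (x \<in> middle \<or> y \<in> middle))"
      using l(2)[of x y] Qm[of x y] mQ[of y x] mm[of x y]
      by (cases "x \<in> middle"; cases "y \<in> middle") (auto simp: l'_def)
  qed simp
  then show ?thesis by blast
qed

section \<open>Necessity of the forbidden posets\<close>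

text \<open>Each forbidden poset contains two 3 + 1 configurations. Their rigid positions either
  contradict each other (4 + 1 and Z) or give two distinct elements the same endpoint and type,
  hence twins.\<close>

lemma endpoint_model_no_forbidden:
  assumes P: "is_poset (X, r)" and tf: "twin_free (X, r)" and m: "endpoint_model (X, r) l opn len"
    and Q: "Q \<in> forbidden_family"
  shows "\<not> contains_induced (X, r) Q"
proof
  have len: "len > 0" and rel: "\<And>x y. x \<in> X \<Longrightarrow> y \<in> X \<Longrightarrow> (x, y) \<in> r \<longleftrightarrow>
        l x + len < l y \<or> (l x + len = l y \<and> (opn x \<or> opn y))"
    using m by (auto simp: endpoint_model_def)
  have sub: "r \<subseteq> X \<times> X"
    using P by (simp add: is_poset_def)
  have twin: "x = y" if "x \<in> X" "y \<in> X" "l x = l y" "opn x = opn y" for x y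
  proof (rule ccontr)
    assume "x \<noteq> y"
    have "(z, x) \<in> r \<longleftrightarrow> (z, y) \<in> r" "(x, z) \<in> r \<longleftrightarrow> (y, z) \<in> r" if "z \<in> X" for z
      using rel[of z x] rel[of z y] rel[of x z] rel[of y z] \<open>z \<in> X\<close> \<open>x \<in> X\<close> \<open>y \<in> X\<close>
        \<open>l x = l y\<close> \<open>opn x = opn y\<close> by simp_all
    then have "twins (X, r) x y"
      using \<open>x \<noteq> y\<close> \<open>x \<in> X\<close> \<open>y \<in> X\<close> unfolding twins_def by auto
    with tf show False by (simp add: twin_free_def)
  qed
  \<comment> \<open>The chain \<open>l a + len \<le> l b \<le> l c - len \<le> l e \<le> l a +
    len\<close> collapses to equalities. Then the failing relations make \<open>a\<close>,
    \<open>e\<close>, \<open>c\<close> closed, and \<open>(a, b) \<in> r\<close> makes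
    \<open>b\<close> open.\<close>
  have rigid: "l b = l e" "l e = l a + len" "l c = l e + len" "opn b" "\<not> opn a" "\<not> opn c" "\<not> opn e"
    if "(a, b) \<in> r" "(b, c) \<in> r" "(a, e) \<notin> r" "(e, c) \<notin> r" "e \<in> X" for a b c e
  proof -
    have X: "a \<in> X" "b \<in> X" "c \<in> X"
      using that sub by auto
    show "l b = l e" "l e = l a + len" "l c = l e + len" "opn b" "\<not> opn a" "\<not> opn c" "\<not> opn e"
      using that rel[of a b] rel[of b c] rel[of a e] rel[of e c] X by auto
  qed
  assume "contains_induced (X, r) Q"
  then obtain g where inj: "inj_on g (fst Q)" and gX: "\<And>i. i \<in> fst Q \<Longrightarrow> g i \<in> X"
    and g: "\<And>i j. i \<in> fst Q \<Longrightarrow> j \<in> fst Q \<Longrightarrow> (i, j) \<in> snd Q \<longleftrightarrow> (g i, g j) \<in> r"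
    unfolding contains_induced_iff by auto
  have g_ne: "g i \<noteq> g j" if "i \<in> fst Q" "j \<in> fst Q" "i \<noteq> j" for i j
    using inj that by (auto dest: inj_onD)
  from Q consider "Q = four_plus_one" | "Q = three_plus_one_plus_one" | "Q = Z_poset" | "Q = D_poset"
    | "Q = Y_poset" | "Q = dual_poset Y_poset"
    unfolding forbidden_family_def by blast
  then show False
  proof cases
    case 1
    note [simp] = 1 four_plus_one_def
    \<comment> \<open>Vertex 2 is the top of the chain 0, 1, 2 and the middle of 1, 2, 3, both with
      vertex 4 isolated.\<close>
    have "l (g 2) = l (g 4) + len"
      by (rule rigid(3)[of "g 0" "g 1"]) (simp_all flip: g add: gX)
    moreover have "l (g 2) = l (g 4)"
      by (rule rigid(1)[of "g 1" _ "g 3"]) (simp_all flip: g add: gX)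
    ultimately show False using len by simp
  next
    case 2
    note [simp] = 2 three_plus_one_plus_one_def
    have "l (g 1) = l (g e)" "\<not> opn (g e)" if "e = 3 \<or> e = 4" for e
      by (rule rigid(1,7)[of "g 0" "g 1" "g 2" "g e"]; use that in \<open>auto simp flip: g simp: gX\<close>)+
    from this[of 3] this[of 4] have "g 3 = g 4"
      by (intro twin) (simp_all add: gX)
    then show False using g_ne[of 3 4] by simp
  next
    case 3
    note [simp] = 3 Z_poset_def
    \<comment> \<open>Vertex 2 is a top with respect to vertex 4, hence closed, and a middle with
      respect to vertex 5, hence open.\<close>
    have "\<not> opn (g 2)"
      by (rule rigid(6)[of "g 0" "g 1" _ "g 4"]) (simp_all flip: g add: gX)
    moreover have "opn (g 2)"
      by (rule rigid(4)[of "g 1" _ "g 3" "g 5"]) (simp_all flip: g add: gX)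
    ultimately show False by simp
  next
    case 4
    note [simp] = 4 D_poset_def
    have "l (g b) = l (g 4)" "opn (g b)" if "b = 1 \<or> b = 2" for b
      by (rule rigid(1,4)[of "g 0" "g b" "g 3" "g 4"]; use that in \<open>auto simp flip: g simp: gX\<close>)+
    from this[of 1] this[of 2] have "g 1 = g 2"
      by (intro twin) (simp_all add: gX)
    then show False using g_ne[of 1 2] by simp
  next
    case 5
    note [simp] = 5 Y_poset_def
    have "l (g c) = l (g 4) + len" "\<not> opn (g c)" if "c = 2 \<or> c = 3" for c
      by (rule rigid(3,6)[of "g 0" "g 1" "g c" "g 4"]; use that in \<open>auto simp flip: g simp: gX\<close>)+
    from this[of 2] this[of 3] have "g 2 = g 3"
      by (intro twin) (simp_all add: gX)
    then show False using g_ne[of 2 3] by simp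
  next
    case 6
    note [simp] = 6 Y_poset_def dual_poset_def
    have "l (g 4) = l (g a) + len" "\<not> opn (g a)" if "a = 2 \<or> a = 3" for a
      by (rule rigid(2,5)[of "g a" "g 1" "g 0" "g 4"]; use that in \<open>auto simp flip: g simp: gX\<close>)+
    from this[of 2] this[of 3] have "g 2 = g 3"
      by (intro twin) (simp_all add: gX)
    then show False using g_ne[of 2 3] by simp
  qed
qed

theorem theorem12:
  fixes P :: "'a poset"
  assumes "is_poset P" and "finite (fst P)" and "twin_free P"
  shows "(unit_OC_interval_order P \<longleftrightarrow> S_order {Type_A, Type_B} P) \<and>
    (S_order {Type_A, Type_B} P \<longleftrightarrow>
      interval_order P \<and> (\<forall>Q \<in> forbidden_family. \<not> contains_induced P Q))"
proof -
  obtain X r where P: "P = (X, r)"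
    by (cases P)
  have "\<exists>l opn len. endpoint_model P l opn len"
    if "interval_order P \<and> (\<forall>Q \<in> forbidden_family. \<not> contains_induced P Q)"
  proof -
    have "rigid_poset X r"
      using rigid_posetI assms that unfolding P by blast
    then show ?thesis
      using rigid_poset.ex_endpoint_model assms(2) unfolding P by fastforce
  qed
  moreover have "interval_order P \<and> (\<forall>Q \<in> forbidden_family. \<not> contains_induced P Q)"
    if "\<exists>l opn len. endpoint_model P l opn len"
    using that endpoint_model_interval_order endpoint_model_no_forbidden assms unfolding P by blast
  ultimately show ?thesis
    using assms(1) unit_OC_iff_endpoint_model AB_order_iff_endpoint_model by blast
qed

end
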